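(* Let $(X,A,m,\alpha,r)$ be a reversible micro-macro system. (a) For non-empty subsets $a_0,\dots,a_n\subseteq X$, $|[\![a_0,\dots,a_n]\!]|=|[\![ra_n,\dots,ra_0]\!]|$, and hence $[\alpha]_{a_0,\dots,a_n}=e^{S(a_n)-S(a_0)}[\alpha]_{ra_n,\dots,ra_0}$. (b) $(p,[\alpha^{-1}]_\bullet)$ is the reversed process of $(p,[\alpha]_\bullet)$: for all $n$ and $a_0,\dots,a_n\in A$, $\Pr_{(p,[\alpha^{-1}]_\bullet)}[X_0=a_0,\dots,X_n=a_n]=\Pr_{(p,[\alpha]_\bullet)}[X_0=a_n,\dots,X_n=a_0]$. (c) The process $(p,[\alpha]_\bullet)$ is reversible if and only if $|[\![a_0,\dots,a_n]\!]|=|[\![a_n,\dots,a_0]\!]|$ for all $n$ and all $a_0,\dots,a_n\in A$. (d) If $r$ is invariant, then $(p,[\alpha]_\bullet)$ is reversible.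
   Context: A micro-macro system $(X,A,m,\alpha)$ consists of finite sets $X$, $A$, a bijection $\alpha:X\to X$ and a surjection $m:X\to A$; identify $a\in A$ with $m^{-1}(a)$. It is reversible with reversion $r:X\to X$ if $r^2=\mathrm{id}$ and $\alpha^{-1}=r\alpha r$; $r$ is invariant if $mr=m$. For subsets $a_0,\dots,a_n\subseteq X$: $[\![a_0,\dots,a_n]\!]=\{i\in a_0:\alpha^t(i)\in a_t\text{ for }0\le t\le n\}$, $[\alpha]_{a_0,\dots,a_n}=|[\![a_0,\dots,a_n]\!]|/|a_0|$, $S(a)=\ln|a|$, $ra=r(a)$. $p_a=|a|/|X|$. For $q\in\mathrm{Prob}(A)$, $(q,[\alpha]_\bullet)$ is the stochastic process on $A^{\mathbb N}$ with $\Pr[X_0=a_0,\dots,X_n=a_n]=q_{a_0}[\alpha]_{a_0,\dots,a_n}$; $(q,[\alpha^{-1}]_\bullet)$ is defined likewise with $\alpha^{-1}$. The process $(p,[\alpha]_\bullet)$ is reversible if $\Pr[X_0=a_0,\dots,X_n=a_n]=\Pr[X_0=a_n,\dots,X_n=a_0]$ for all $n$ and $a_0,\dots,a_n$. *)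

theory Defs
  imports "HOL-Probability.Probability"
begin

locale micro_macro_system =
  fixes X :: "'x set" and A :: "'a set" and m :: "'x \<Rightarrow> 'a" and \<alpha> :: "'x \<Rightarrow> 'x"
  assumes finite_micro: "finite X"
    and finite_macro: "finite A"
    and dynamics_bij: "bij_betw \<alpha> X X"
    and macro_surj: "m ` X = A"

locale reversible_micro_macro_system = micro_macro_system X A m \<alpha>
  for X :: "'x set" and A :: "'a set" and m :: "'x \<Rightarrow> 'a" and \<alpha> :: "'x \<Rightarrow> 'x" +
  fixes r :: "'x \<Rightarrow> 'x"
  assumes reversion_closed: "r ` X \<subseteq> X"
    and reversion_involution: "\<forall>i\<in>X. r (r i) = i"
    and reversion_conjugates: "\<forall>i\<in>X. inv_into X \<alpha> i = r (\<alpha> (r i))"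

definition invariant_reversion :: "'x set \<Rightarrow> ('x \<Rightarrow> 'a) \<Rightarrow> ('x \<Rightarrow> 'x) \<Rightarrow> bool" where
  "invariant_reversion X m r \<longleftrightarrow> (\<forall>i\<in>X. m (r i) = m i)"

text \<open>A finite sequence \<open>a\<^sub>0, \<dots>, a\<^sub>n\<close> is given by a function on \<^typ>\<open>nat\<close> together with its last
  index \<open>n\<close>; values beyond \<open>n\<close> are irrelevant. The reversed sequence is \<open>\<lambda>t. a (n - t)\<close>.\<close>

definition trajectories :: "('x \<Rightarrow> 'x) \<Rightarrow> nat \<Rightarrow> (nat \<Rightarrow> 'x set) \<Rightarrow> 'x set" where
  "trajectories \<beta> n a = {i \<in> a 0. \<forall>t\<le>n. (\<beta> ^^ t) i \<in> a t}"

definition trajectory_prob :: "('x \<Rightarrow> 'x) \<Rightarrow> nat \<Rightarrow> (nat \<Rightarrow> 'x set) \<Rightarrow> real" where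
  "trajectory_prob \<beta> n a = real (card (trajectories \<beta> n a)) / real (card (a 0))"

definition boltzmann_entropy :: "'x set \<Rightarrow> real" where
  "boltzmann_entropy a = ln (real (card a))"

definition macro_fiber :: "'x set \<Rightarrow> ('x \<Rightarrow> 'a) \<Rightarrow> 'a \<Rightarrow> 'x set" where
  "macro_fiber X m a = {i \<in> X. m i = a}"

definition macro_weight :: "'x set \<Rightarrow> ('x \<Rightarrow> 'a) \<Rightarrow> 'a \<Rightarrow> real" where
  "macro_weight X m a = real (card (macro_fiber X m a)) / real (card X)"

definition prob_vectors :: "'a set \<Rightarrow> ('a \<Rightarrow> real) set" where
  "prob_vectors A = {q. (\<forall>a\<in>A. 0 \<le> q a) \<and> (\<Sum>a\<in>A. q a) = 1}"

text \<open>A stochastic process on \<open>A\<^sup>\<nat>\<close> is represented by its law \<open>M\<close> on the product measurable space,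
  with the coordinate maps as the random variables.\<close>

definition path_space :: "'a set \<Rightarrow> (nat \<Rightarrow> 'a) measure" where
  "path_space A = PiM UNIV (\<lambda>_. count_space A)"

definition path_prob :: "(nat \<Rightarrow> 'a) measure \<Rightarrow> nat \<Rightarrow> (nat \<Rightarrow> 'a) \<Rightarrow> real" where
  "path_prob M n a = measure M {\<omega> \<in> space M. \<forall>t\<le>n. \<omega> t = a t}"

definition is_macro_process ::
    "'x set \<Rightarrow> 'a set \<Rightarrow> ('x \<Rightarrow> 'a) \<Rightarrow> ('x \<Rightarrow> 'x) \<Rightarrow> ('a \<Rightarrow> real) \<Rightarrow> (nat \<Rightarrow> 'a) measure \<Rightarrow> bool" where
  "is_macro_process X A m \<beta> q M \<longleftrightarrow>
     prob_space M \<and> sets M = sets (path_space A) \<and>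
     (\<forall>n a. (\<forall>t\<le>n. a t \<in> A) \<longrightarrow>
        path_prob M n a = q (a 0) * trajectory_prob \<beta> n (\<lambda>t. macro_fiber X m (a t)))"

text \<open>Existence and uniqueness of this law are established in \<open>ex1_macro_process\<close> below.\<close>

definition macro_process ::
    "'x set \<Rightarrow> 'a set \<Rightarrow> ('x \<Rightarrow> 'a) \<Rightarrow> ('x \<Rightarrow> 'x) \<Rightarrow> ('a \<Rightarrow> real) \<Rightarrow> (nat \<Rightarrow> 'a) measure" where
  "macro_process X A m \<beta> q = (THE M. is_macro_process X A m \<beta> q M)"

definition is_reversed_process ::
    "'a set \<Rightarrow> (nat \<Rightarrow> 'a) measure \<Rightarrow> (nat \<Rightarrow> 'a) measure \<Rightarrow> bool" where
  "is_reversed_process A N M \<longleftrightarrow>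
     (\<forall>n a. (\<forall>t\<le>n. a t \<in> A) \<longrightarrow> path_prob N n a = path_prob M n (\<lambda>t. a (n - t)))"

definition reversible_process :: "'a set \<Rightarrow> (nat \<Rightarrow> 'a) measure \<Rightarrow> bool" where
  "reversible_process A M \<longleftrightarrow>
     (\<forall>n a. (\<forall>t\<le>n. a t \<in> A) \<longrightarrow> path_prob M n a = path_prob M n (\<lambda>t. a (n - t)))"

lemma space_path_space: "space (path_space A) = {\<omega>. \<forall>t. \<omega> t \<in> A}"
  by (auto simp: path_space_def space_PiM)

lemma cylinder_in_sets:
  assumes "sets M = sets (path_space A)" "\<forall>t\<le>n. a t \<in> A"
  shows "{\<omega> \<in> space M. \<forall>t\<le>n. \<omega> t = a t} \<in> sets M"
proof -
  have sp: "space M = space (path_space A)" using assms(1) by (rule sets_eq_imp_space_eq)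
  have "{\<omega> \<in> space (path_space A). \<forall>t\<in>{..n}. \<omega> t \<in> {a t}} \<in> sets (path_space A)"
  proof (rule sets.sets_Collect_finite_All)
    fix t assume "t \<in> {..n}"
    have "(\<lambda>\<omega>. \<omega> t) \<in> measurable (path_space A) (count_space A)"
      unfolding path_space_def by (rule measurable_component_singleton) simp
    from measurable_sets[OF this, of "{a t}"]
    have "(\<lambda>\<omega>. \<omega> t) -` {a t} \<inter> space (path_space A) \<in> sets (path_space A)"
      using assms(2) \<open>t \<in> {..n}\<close> by simp
    also have "(\<lambda>\<omega>. \<omega> t) -` {a t} \<inter> space (path_space A) = {\<omega> \<in> space (path_space A). \<omega> t \<in> {a t}}"
      by auto
    finally show "{\<omega> \<in> space (path_space A). \<omega> t \<in> {a t}} \<in> sets (path_space A)" .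
  qed simp
  then show ?thesis by (simp only: sp assms(1) atMost_iff Ball_def singleton_iff)
qed

lemma macro_process_unique:
  assumes A: "finite A"
    and M: "is_macro_process X A m \<beta> q M" and N: "is_macro_process X A m \<beta> q N"
  shows "M = N"
proof -
  interpret M: prob_space M using M by (simp add: is_macro_process_def)
  interpret N: prob_space N using N by (simp add: is_macro_process_def)
  have sM: "sets M = sets (path_space A)" and sN: "sets N = sets (path_space A)"
    using M N by (auto simp: is_macro_process_def)
  have spM: "space M = {\<omega>. \<forall>t. \<omega> t \<in> A}" and spN: "space N = {\<omega>. \<forall>t. \<omega> t \<in> A}"
    using sets_eq_imp_space_eq[OF sM] sets_eq_imp_space_eq[OF sN] by (auto simp: space_path_space)
  define cyl where "cyl n a = {\<omega>::nat \<Rightarrow> 'a. (\<forall>t. \<omega> t \<in> A) \<and> (\<forall>t\<le>n. \<omega> t = a t)}" for n :: nat and a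
  have eq: "measure M (cyl n a) = measure N (cyl n a)" if "\<forall>t\<le>n. a t \<in> A" for n a
  proof -
    have "path_prob M n a = path_prob N n a" using M N that by (simp add: is_macro_process_def)
    then show ?thesis by (simp add: path_prob_def cyl_def spM spN)
  qed
  have cylM: "cyl n a \<in> sets M" and cylN: "cyl n a \<in> sets N" if "\<forall>t\<le>n. a t \<in> A" for n a
    using cylinder_in_sets[OF sM that] cylinder_in_sets[OF sN that] by (auto simp: cyl_def spM spN)
  show ?thesis
  proof (rule measure_eqI_PiM_infinite)
    show "sets M = sets (PiM UNIV (\<lambda>_. count_space A))" "sets N = sets (PiM UNIV (\<lambda>_. count_space A))"
      using sM sN by (auto simp: path_space_def)
    show "finite_measure M" by unfold_locales
    fix F :: "nat \<Rightarrow> 'a set" and J :: "nat set"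
    assume J: "finite J" and F: "\<And>i. i \<in> J \<Longrightarrow> F i \<in> sets (count_space A)"
    obtain n where n: "J \<subseteq> {..n}" using J finite_nat_iff_bounded_le by auto
    define B where "B = {a \<in> {..n} \<rightarrow>\<^sub>E A. \<forall>j\<in>J. a j \<in> F j}"
    have finB: "finite B" unfolding B_def using A by (simp add: finite_PiE)
    have box: "prod_emb UNIV (\<lambda>_. count_space A) J (Pi\<^sub>E J F) = (\<Union>a\<in>B. cyl n a)"
    proof (intro equalityI subsetI)
      fix \<omega> assume "\<omega> \<in> prod_emb UNIV (\<lambda>_. count_space A) J (Pi\<^sub>E J F)"
      then have w: "\<forall>t. \<omega> t \<in> A" "\<forall>j\<in>J. \<omega> j \<in> F j"
        by (auto simp: prod_emb_def restrict_PiE_iff)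
      have "restrict \<omega> {..n} \<in> B" using w n by (auto simp: B_def)
      moreover have "\<omega> \<in> cyl n (restrict \<omega> {..n})" using w by (auto simp: cyl_def)
      ultimately show "\<omega> \<in> (\<Union>a\<in>B. cyl n a)" by blast
    next
      fix \<omega> assume "\<omega> \<in> (\<Union>a\<in>B. cyl n a)"
      then obtain a where a: "a \<in> B" "\<omega> \<in> cyl n a" by blast
      then have "\<forall>j\<in>J. \<omega> j \<in> F j" using n by (auto simp: B_def cyl_def subset_eq)
      then show "\<omega> \<in> prod_emb UNIV (\<lambda>_. count_space A) J (Pi\<^sub>E J F)"
        using a by (auto simp: prod_emb_def restrict_PiE_iff cyl_def)
    qed
    have disj: "disjoint_family_on (cyl n) B"
      unfolding disjoint_family_on_def
    proof (intro ballI impI)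
      fix a b assume ab: "a \<in> B" "b \<in> B" "a \<noteq> b"
      have "a = b" if "\<omega> \<in> cyl n a" "\<omega> \<in> cyl n b" for \<omega>
      proof (rule PiE_ext)
        show "a \<in> {..n} \<rightarrow>\<^sub>E A" "b \<in> {..n} \<rightarrow>\<^sub>E A" using ab by (auto simp: B_def)
        show "a t = b t" if "t \<in> {..n}" for t
          using \<open>\<omega> \<in> cyl n a\<close> \<open>\<omega> \<in> cyl n b\<close> that by (auto simp: cyl_def)
      qed
      then show "cyl n a \<inter> cyl n b = {}" using ab by blast
    qed
    have BA: "\<forall>t\<le>n. a t \<in> A" if "a \<in> B" for a using that by (auto simp: B_def)
    have "measure M (\<Union>a\<in>B. cyl n a) = (\<Sum>a\<in>B. measure M (cyl n a))"
      using finB disj cylM BA by (intro M.finite_measure_finite_Union) auto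
    also have "\<dots> = (\<Sum>a\<in>B. measure N (cyl n a))"
      using eq BA by (intro sum.cong) auto
    also have "\<dots> = measure N (\<Union>a\<in>B. cyl n a)"
      using finB disj cylN BA by (intro N.finite_measure_finite_Union[symmetric]) auto
    finally show "emeasure M (prod_emb UNIV (\<lambda>_. count_space A) J (Pi\<^sub>E J F)) =
        emeasure N (prod_emb UNIV (\<lambda>_. count_space A) J (Pi\<^sub>E J F))"
      by (simp add: box M.emeasure_eq_measure N.emeasure_eq_measure)
  qed
qed

lemma macro_process_exists:
  assumes X: "finite X" and A: "m ` X = A" and b: "\<beta> ` X \<subseteq> X" and q: "q \<in> prob_vectors A"
  shows "\<exists>M. is_macro_process X A m \<beta> q M"
proof -
  define w where "w i = q (m i) / real (card (macro_fiber X m (m i)))" for i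
  have w0: "0 \<le> w i" if "i \<in> X" for i using that q A by (auto simp: w_def prob_vectors_def)
  define P where "P = point_measure X (\<lambda>i. ennreal (w i))"
  define f where "f i = (\<lambda>t::nat. m ((\<beta> ^^ t) i))" for i
  define M where "M = distr P (path_space A) f"
  have iter: "(\<beta> ^^ t) i \<in> X" if "i \<in> X" for t i using that b by (induction t) auto
  have spP: "space P = X" by (simp add: P_def space_point_measure)
  have f_space: "f i \<in> space (path_space A)" if "i \<in> X" for i
    using that iter A by (auto simp: space_path_space f_def)
  have f_meas: "f \<in> measurable P (path_space A)"
    using f_space by (auto simp: P_def)
  have mP: "emeasure P Y = ennreal (\<Sum>i\<in>Y. w i)" if "Y \<subseteq> X" for Y
    using that X w0 by (auto simp: P_def emeasure_point_measure_finite subset_eq intro!: sum_ennreal)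
  have fib: "card (macro_fiber X m a) > 0" if "a \<in> A" for a
    using that A X by (auto simp: macro_fiber_def card_gt_0_iff)
  have "(\<Sum>i\<in>X. w i) = (\<Sum>a\<in>A. \<Sum>i\<in>macro_fiber X m a. w i)"
    using sum.image_gen[OF X, of w m] by (simp add: A macro_fiber_def)
  also have "\<dots> = (\<Sum>a\<in>A. \<Sum>i\<in>macro_fiber X m a. q a / real (card (macro_fiber X m a)))"
    by (intro sum.cong) (auto simp: w_def macro_fiber_def)
  also have "\<dots> = (\<Sum>a\<in>A. q a)" using fib by (intro sum.cong) auto
  also have "\<dots> = 1" using q by (simp add: prob_vectors_def)
  finally have "(\<Sum>i\<in>X. w i) = 1" .
  then have "prob_space P" by (intro prob_spaceI) (simp add: spP mP)
  then have pM: "prob_space M" unfolding M_def by (rule prob_space.prob_space_distr) (rule f_meas)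
  have sM: "sets M = sets (path_space A)" by (simp add: M_def)
  have spM: "space M = space (path_space A)" by (simp add: M_def)
  have "path_prob M n a = q (a 0) * trajectory_prob \<beta> n (\<lambda>t. macro_fiber X m (a t))"
    if a: "\<forall>t\<le>n. a t \<in> A" for n a
  proof -
    define T where "T = trajectories \<beta> n (\<lambda>t. macro_fiber X m (a t))"
    have TX: "T \<subseteq> X" and Ta: "i \<in> T \<Longrightarrow> m i = a 0" for i
      by (auto simp: T_def trajectories_def macro_fiber_def)
    have pre: "f -` {\<omega> \<in> space M. \<forall>t\<le>n. \<omega> t = a t} \<inter> space P = T"
      using f_space iter by (auto simp: T_def trajectories_def macro_fiber_def spP spM f_def)
    have cyl: "{\<omega> \<in> space M. \<forall>t\<le>n. \<omega> t = a t} \<in> sets (path_space A)"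
      using cylinder_in_sets[OF sM a] by (simp only: sM)
    have "path_prob M n a = measure P T"
      unfolding path_prob_def using measure_distr[OF f_meas cyl] by (simp only: pre M_def[symmetric])
    also have "\<dots> = (\<Sum>i\<in>T. w i)"
    proof -
      have "0 \<le> (\<Sum>i\<in>T. w i)" using TX w0 by (intro sum_nonneg) blast
      then show ?thesis using mP[OF TX] by (intro measure_eq_emeasure_eq_ennreal)
    qed
    also have "\<dots> = (\<Sum>i\<in>T. q (a 0) / real (card (macro_fiber X m (a 0))))"
      using Ta by (intro sum.cong) (auto simp: w_def)
    also have "\<dots> = q (a 0) * trajectory_prob \<beta> n (\<lambda>t. macro_fiber X m (a t))"
      by (simp add: trajectory_prob_def T_def)
    finally show ?thesis .
  qed
  then show ?thesis using pM sM by (auto simp: is_macro_process_def)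
qed

lemma ex1_macro_process:
  assumes "finite X" "m ` X = A" "\<beta> ` X \<subseteq> X" "q \<in> prob_vectors A"
  shows "\<exists>!M. is_macro_process X A m \<beta> q M"
proof (rule ex_ex1I)
  show "\<exists>M. is_macro_process X A m \<beta> q M" using assms by (rule macro_process_exists)
  have "finite A" using assms(1,2) by auto
  then show "M = N" if "is_macro_process X A m \<beta> q M" "is_macro_process X A m \<beta> q N" for M N
    using that by (rule macro_process_unique)
qed

lemma macro_weight_prob_vector:
  assumes "finite X" "X \<noteq> {}" "m ` X = A"
  shows "macro_weight X m \<in> prob_vectors A"
proof -
  have "(\<Sum>a\<in>A. card (macro_fiber X m a)) = card X"
    using sum.image_gen[OF assms(1), of "\<lambda>_. 1::nat" m] assms(3) by (simp add: macro_fiber_def)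
  then have "(\<Sum>a\<in>A. real (card (macro_fiber X m a))) = real (card X)"
    by (metis of_nat_sum)
  then show ?thesis using assms
    by (simp add: prob_vectors_def macro_weight_def flip: sum_divide_distrib)
qed

end

theory Submission
  imports Defs
begin

text \<open>Following an orbit for \<open>n\<close> steps and then running the dynamics backwards identifies
  \<open>\<lbrakk>a\<^sub>0, \<dots>, a\<^sub>n\<rbrakk>\<close> for \<open>\<alpha>\<close> with \<open>\<lbrakk>a\<^sub>n, \<dots>, a\<^sub>0\<rbrakk>\<close> for \<open>\<alpha>\<^sup>-\<^sup>1\<close>, via the bijection \<open>\<alpha>\<^sup>n\<close>; the reversion \<open>r\<close>,
  which intertwines \<open>\<alpha>\<^sup>-\<^sup>1\<close> with \<open>\<alpha>\<close>, carries the latter onto \<open>\<lbrakk>ra\<^sub>n, \<dots>, ra\<^sub>0\<rbrakk>\<close> for \<open>\<alpha>\<close>. Since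
  \<open>p\<^sub>a = |a|/|X|\<close>, path probabilities of the stationary process are these cardinalities divided by
  \<open>|X|\<close>, so all four claims reduce to counting.\<close>

lemma trajectories_cong:
  assumes "\<And>t. t \<le> n \<Longrightarrow> a t = b t"
  shows "trajectories \<beta> n a = trajectories \<beta> n b"
  using assms by (auto simp: trajectories_def)

lemma trajectories_subset: "trajectories \<beta> n a \<subseteq> a 0"
  by (auto simp: trajectories_def)

lemma trajectoriesD: "i \<in> trajectories \<beta> n a \<Longrightarrow> t \<le> n \<Longrightarrow> (\<beta> ^^ t) i \<in> a t"
  by (auto simp: trajectories_def)

lemma trajectoriesI: "(\<And>t. t \<le> n \<Longrightarrow> (\<beta> ^^ t) i \<in> a t) \<Longrightarrow> i \<in> trajectories \<beta> n a"
  by (force simp: trajectories_def)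

lemma funpow_closed: "\<beta> ` X \<subseteq> X \<Longrightarrow> i \<in> X \<Longrightarrow> (\<beta> ^^ t) i \<in> X"
  by (induction t) auto

text \<open>Each \<gamma> peels off one \<beta>; since \<gamma> undoes \<beta> only on
  \<open>X\<close>, the orbit has to stay there. The pair is kept abstract so that \<alpha> and its
  inverse can take either role.\<close>

lemma funpow_left_inverse:
  assumes closed: "\<beta> ` X \<subseteq> X" and inv: "\<And>i. i \<in> X \<Longrightarrow> \<gamma> (\<beta> i) = i"
    and i: "i \<in> X" and "t \<le> n"
  shows "(\<gamma> ^^ t) ((\<beta> ^^ n) i) = (\<beta> ^^ (n - t)) i"
  using \<open>t \<le> n\<close>
proof (induction t)
  case (Suc t)
  then have "n - t = Suc (n - Suc t)" by simp
  then have "(\<beta> ^^ (n - t)) i = \<beta> ((\<beta> ^^ (n - Suc t)) i)"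
    by (metis comp_apply funpow.simps(2))
  then show ?case using Suc inv funpow_closed[OF closed i] by simp
qed simp

text \<open>The endpoint of an orbit, run backwards, meets the prescribed sets in the opposite
  order.\<close>

lemma funpow_mem_reversed_trajectories:
  assumes closed: "\<beta> ` X \<subseteq> X" and inv: "\<And>i. i \<in> X \<Longrightarrow> \<gamma> (\<beta> i) = i"
    and a: "a 0 \<subseteq> X" and i: "i \<in> trajectories \<beta> n a"
  shows "(\<beta> ^^ n) i \<in> trajectories \<gamma> n (\<lambda>t. a (n - t))"
proof (rule trajectoriesI)
  fix t assume t: "t \<le> n"
  have "i \<in> X" using a i trajectories_subset[of \<beta> n a] by blast
  from funpow_left_inverse[OF closed inv this t] trajectoriesD[OF i, of "n - t"]
  show "(\<gamma> ^^ t) ((\<beta> ^^ n) i) \<in> a (n - t)" by simp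
qed

context micro_macro_system
begin

lemma inv_dynamics_closed: "inv_into X \<alpha> ` X \<subseteq> X"
  using bij_betw_inv_into[OF dynamics_bij] by (simp add: bij_betw_def)

text \<open>Sending a starting point to its endpoint is a bijection: both directions are the same
  lemma with the two maps exchanged.\<close>

lemma card_trajectories_inv:
  assumes a: "\<And>t. t \<le> n \<Longrightarrow> a t \<subseteq> X"
  shows "card (trajectories (inv_into X \<alpha>) n (\<lambda>t. a (n - t))) = card (trajectories \<alpha> n a)"
proof -
  let ?\<beta> = "inv_into X \<alpha>" and ?b = "\<lambda>t. a (n - t)"
  have closed: "\<alpha> ` X \<subseteq> X" using dynamics_bij by (simp add: bij_betw_def)
  have inv: "?\<beta> (\<alpha> i) = i" "\<alpha> (?\<beta> i) = i" if "i \<in> X" for i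
    using that dynamics_bij by (auto simp: bij_betw_def f_inv_into_f)
  have sub: "trajectories \<alpha> n a \<subseteq> X" "trajectories ?\<beta> n ?b \<subseteq> X"
    using a[of 0] a[of n] trajectories_subset[of \<alpha> n a] trajectories_subset[of ?\<beta> n ?b] by auto
  have "bij_betw (\<alpha> ^^ n) (trajectories \<alpha> n a) (trajectories ?\<beta> n ?b)"
  proof (rule bij_betw_byWitness[where f' = "?\<beta> ^^ n"])
    show "\<forall>i\<in>trajectories \<alpha> n a. (?\<beta> ^^ n) ((\<alpha> ^^ n) i) = i"
      using sub funpow_left_inverse[of \<alpha> X ?\<beta> _ n n] closed inv by auto
    show "\<forall>i\<in>trajectories ?\<beta> n ?b. (\<alpha> ^^ n) ((?\<beta> ^^ n) i) = i"
      using sub funpow_left_inverse[of ?\<beta> X \<alpha> _ n n] inv_dynamics_closed inv by auto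
    show "(\<alpha> ^^ n) ` trajectories \<alpha> n a \<subseteq> trajectories ?\<beta> n ?b"
      using funpow_mem_reversed_trajectories[of \<alpha> X ?\<beta> a _ n] closed inv a by auto
    \<comment> \<open>Subtraction truncates, so reversing twice restores \<open>a\<close> only at
      indices up to \<open>n\<close>, which is all that \<open>trajectories\<close> reads.\<close>
    have "trajectories \<alpha> n (\<lambda>t. ?b (n - t)) = trajectories \<alpha> n a"
      by (rule trajectories_cong) simp
    then show "(?\<beta> ^^ n) ` trajectories ?\<beta> n ?b \<subseteq> trajectories \<alpha> n a"
      using funpow_mem_reversed_trajectories[of ?\<beta> X \<alpha> ?b _ n] inv_dynamics_closed inv a by auto
  qed
  then show ?thesis by (simp add: bij_betw_same_card)
qed

text \<open>The initial weight |a0|/|X| cancels the denominator |a0| of the trajectory probability,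
  leaving a pure count over |X|.\<close>

lemma path_prob_macro_process:
  assumes \<beta>: "\<beta> ` X \<subseteq> X" and a: "\<forall>t\<le>n. a t \<in> A"
  shows "path_prob (macro_process X A m \<beta> (macro_weight X m)) n a =
    real (card (trajectories \<beta> n (\<lambda>t. macro_fiber X m (a t)))) / real (card X)"
proof -
  \<comment> \<open>The sequence itself supplies a macrostate, hence a point of \<open>X\<close>;
    without one the weights could not sum to 1 and \<open>THE\<close> would have no witness.\<close>
  have a0: "a 0 \<in> A" using a by simp
  then have "X \<noteq> {}" using macro_surj by auto
  then have "macro_weight X m \<in> prob_vectors A"
    by (rule macro_weight_prob_vector[OF finite_micro _ macro_surj])
  then have "is_macro_process X A m \<beta> (macro_weight X m) (macro_process X A m \<beta> (macro_weight X m))"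
    unfolding macro_process_def
    by (rule theI'[OF ex1_macro_process[OF finite_micro macro_surj \<beta>]])
  moreover have "card (macro_fiber X m (a 0)) \<noteq> 0"
    using a0 macro_surj finite_micro by (auto simp: macro_fiber_def)
  ultimately show ?thesis
    using a by (simp add: is_macro_process_def macro_weight_def trajectory_prob_def)
qed

lemma inv_dynamics_is_reversed_process:
  "is_reversed_process A (macro_process X A m (inv_into X \<alpha>) (macro_weight X m))
     (macro_process X A m \<alpha> (macro_weight X m))"
  unfolding is_reversed_process_def
proof (intro allI impI)
  fix n and a :: "nat \<Rightarrow> 'a" assume a: "\<forall>t\<le>n. a t \<in> A"
  have "trajectories (inv_into X \<alpha>) n (\<lambda>t. macro_fiber X m (a (n - (n - t)))) =
      trajectories (inv_into X \<alpha>) n (\<lambda>t. macro_fiber X m (a t))"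
    by (rule trajectories_cong) simp
  with card_trajectories_inv[of n "\<lambda>t. macro_fiber X m (a (n - t))"]
  have "card (trajectories (inv_into X \<alpha>) n (\<lambda>t. macro_fiber X m (a t))) =
      card (trajectories \<alpha> n (\<lambda>t. macro_fiber X m (a (n - t))))"
    by (simp add: macro_fiber_def)
  then show "path_prob (macro_process X A m (inv_into X \<alpha>) (macro_weight X m)) n a =
      path_prob (macro_process X A m \<alpha> (macro_weight X m)) n (\<lambda>t. a (n - t))"
    using a dynamics_bij inv_dynamics_closed
    by (simp add: path_prob_macro_process bij_betw_def)
qed

lemma reversible_process_iff_card:
  "reversible_process A (macro_process X A m \<alpha> (macro_weight X m)) \<longleftrightarrow>
     (\<forall>n a. (\<forall>t\<le>n. a t \<in> A) \<longrightarrow>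
        card (trajectories \<alpha> n (\<lambda>t. macro_fiber X m (a t))) =
        card (trajectories \<alpha> n (\<lambda>t. macro_fiber X m (a (n - t)))))"
  unfolding reversible_process_def
proof (intro all_cong1 imp_cong refl)
  fix n and a :: "nat \<Rightarrow> 'a" assume a: "\<forall>t\<le>n. a t \<in> A"
  then have "a 0 \<in> A" by simp
  \<comment> \<open>Division by 0 yields 0, so equal quotients give equal counts only for a nonzero
    denominator.\<close>
  then have "card X \<noteq> 0" using macro_surj finite_micro by auto
  then show "path_prob (macro_process X A m \<alpha> (macro_weight X m)) n a =
      path_prob (macro_process X A m \<alpha> (macro_weight X m)) n (\<lambda>t. a (n - t)) \<longleftrightarrow>
      card (trajectories \<alpha> n (\<lambda>t. macro_fiber X m (a t))) =
      card (trajectories \<alpha> n (\<lambda>t. macro_fiber X m (a (n - t))))"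
    using a dynamics_bij by (simp add: path_prob_macro_process bij_betw_def)
qed

end

context reversible_micro_macro_system
begin

lemma reversion_inj_on: "inj_on r X"
  using reversion_involution by (metis inj_on_inverseI)

text \<open>The conjugation relation iterated: with j the current backward iterate, \<alpha> (r j) =
  r (r (\<alpha> (r j))), and the inner r (\<alpha> (r j)) is the next backward iterate.\<close>

lemma funpow_reversion:
  assumes "i \<in> X"
  shows "(\<alpha> ^^ t) (r i) = r ((inv_into X \<alpha> ^^ t) i)"
proof (induction t)
  case (Suc t)
  let ?j = "(inv_into X \<alpha> ^^ t) i"
  have j: "?j \<in> X" by (rule funpow_closed[OF inv_dynamics_closed assms])
  then have "\<alpha> (r ?j) \<in> X"
    using reversion_closed dynamics_bij by (auto simp: bij_betw_def)
  then show ?case using Suc j reversion_conjugates reversion_involution by simp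
qed simp

lemma trajectories_reversion:
  assumes a: "\<And>t. t \<le> n \<Longrightarrow> a t \<subseteq> X"
  shows "trajectories \<alpha> n (\<lambda>t. r ` a t) = r ` trajectories (inv_into X \<alpha>) n a"
proof -
  have mem: "r i \<in> trajectories \<alpha> n (\<lambda>t. r ` a t) \<longleftrightarrow> i \<in> trajectories (inv_into X \<alpha>) n a"
    if i: "i \<in> X" for i
  proof -
    have "r ((inv_into X \<alpha> ^^ t) i) \<in> r ` a t \<longleftrightarrow> (inv_into X \<alpha> ^^ t) i \<in> a t" if "t \<le> n" for t
      using inj_on_image_mem_iff[OF reversion_inj_on] a[OF that]
        funpow_closed[OF inv_dynamics_closed i] by blast
    then show ?thesis
      using funpow_reversion[OF i] by (force simp: trajectories_def)
  qed
  have "trajectories \<alpha> n (\<lambda>t. r ` a t) \<subseteq> r ` X"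
    using trajectories_subset[of \<alpha> n "\<lambda>t. r ` a t"] a[of 0] by auto
  moreover have "trajectories (inv_into X \<alpha>) n a \<subseteq> X"
    using trajectories_subset[of "inv_into X \<alpha>" n a] a[of 0] by auto
  ultimately show ?thesis using mem by blast
qed

text \<open>Time reversal by the inverse dynamics followed by transport along the injective
  \<open>r\<close>; both preserve cardinality.\<close>

lemma card_trajectories_reversion:
  assumes a: "\<And>t. t \<le> n \<Longrightarrow> a t \<subseteq> X"
  shows "card (trajectories \<alpha> n (\<lambda>t. r ` a (n - t))) = card (trajectories \<alpha> n a)"
proof -
  have "trajectories (inv_into X \<alpha>) n (\<lambda>t. a (n - t)) \<subseteq> X"
    using trajectories_subset[of "inv_into X \<alpha>" n "\<lambda>t. a (n - t)"] a[of n] by auto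
  then have "inj_on r (trajectories (inv_into X \<alpha>) n (\<lambda>t. a (n - t)))"
    using reversion_inj_on inj_on_subset by blast
  then show ?thesis
    using trajectories_reversion[of n "\<lambda>t. a (n - t)"] card_trajectories_inv[of n a] a
    by (simp add: card_image)
qed

text \<open>The numerators agree, and the exponential is |a n|/|a 0|, which exchanges the
  denominators because \<open>r\<close> preserves the size of \<open>a n\<close>.\<close>

lemma trajectory_prob_reversion:
  assumes a: "\<And>t. t \<le> n \<Longrightarrow> a t \<subseteq> X" "a 0 \<noteq> {}" "a n \<noteq> {}"
  shows "trajectory_prob \<alpha> n a =
    exp (boltzmann_entropy (a n) - boltzmann_entropy (a 0)) *
    trajectory_prob \<alpha> n (\<lambda>t. r ` a (n - t))"
proof -
  have pos: "card (a 0) > 0" "card (a n) > 0"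
    using a(1)[of 0] a(1)[of n] a(2,3) finite_micro by (auto simp: card_gt_0_iff finite_subset)
  have "card (r ` a n) = card (a n)"
    using card_image[OF inj_on_subset[OF reversion_inj_on a(1)[of n]]] by simp
  then show ?thesis
    using pos card_trajectories_reversion[of n a] a(1)
    by (simp add: trajectory_prob_def boltzmann_entropy_def exp_diff)
qed

lemma reversion_image_macro_fiber:
  assumes "invariant_reversion X m r"
  shows "r ` macro_fiber X m a = macro_fiber X m a"
proof
  show sub: "r ` macro_fiber X m a \<subseteq> macro_fiber X m a"
    using assms reversion_closed by (auto simp: invariant_reversion_def macro_fiber_def)
  show "macro_fiber X m a \<subseteq> r ` macro_fiber X m a"
  proof
    fix i assume i: "i \<in> macro_fiber X m a"
    then have "r (r i) = i" using reversion_involution by (simp add: macro_fiber_def)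
    then show "i \<in> r ` macro_fiber X m a" using i sub by (metis image_eqI image_subset_iff)
  qed
qed

lemma invariant_reversion_imp_reversible_process:
  assumes "invariant_reversion X m r"
  shows "reversible_process A (macro_process X A m \<alpha> (macro_weight X m))"
  unfolding reversible_process_iff_card
proof (intro allI impI)
  fix n and a :: "nat \<Rightarrow> 'a"
  show "card (trajectories \<alpha> n (\<lambda>t. macro_fiber X m (a t))) =
      card (trajectories \<alpha> n (\<lambda>t. macro_fiber X m (a (n - t))))"
    using card_trajectories_reversion[of n "\<lambda>t. macro_fiber X m (a t)"]
    \<comment> \<open>Fibres must absorb \<open>r\<close> while still folded; unfolding them
      afterwards shows that they lie in \<open>X\<close>.\<close>
    by (simp add: reversion_image_macro_fiber[OF assms]) (simp add: macro_fiber_def)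
qed

end

theorem theorem22:
  fixes X :: "'x set" and A :: "'a set" and m :: "'x \<Rightarrow> 'a"
    and \<alpha> :: "'x \<Rightarrow> 'x" and r :: "'x \<Rightarrow> 'x"
  assumes "reversible_micro_macro_system X A m \<alpha> r"
  shows
    "(\<forall>n (a :: nat \<Rightarrow> 'x set). (\<forall>t\<le>n. a t \<subseteq> X \<and> a t \<noteq> {}) \<longrightarrow>
        card (trajectories \<alpha> n a) = card (trajectories \<alpha> n (\<lambda>t. r ` a (n - t))) \<and>
        trajectory_prob \<alpha> n a =
          exp (boltzmann_entropy (a n) - boltzmann_entropy (a 0)) *
          trajectory_prob \<alpha> n (\<lambda>t. r ` a (n - t)))
     \<and> is_reversed_process A (macro_process X A m (inv_into X \<alpha>) (macro_weight X m))
          (macro_process X A m \<alpha> (macro_weight X m))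
     \<and> (reversible_process A (macro_process X A m \<alpha> (macro_weight X m)) \<longleftrightarrow>
          (\<forall>n a. (\<forall>t\<le>n. a t \<in> A) \<longrightarrow>
             card (trajectories \<alpha> n (\<lambda>t. macro_fiber X m (a t))) =
             card (trajectories \<alpha> n (\<lambda>t. macro_fiber X m (a (n - t))))))
     \<and> (invariant_reversion X m r \<longrightarrow> reversible_process A (macro_process X A m \<alpha> (macro_weight X m)))"
proof -
  interpret reversible_micro_macro_system X A m \<alpha> r by (rule assms)
  show ?thesis
  proof (intro conjI allI impI)
    fix n and a :: "nat \<Rightarrow> 'x set" assume "\<forall>t\<le>n. a t \<subseteq> X \<and> a t \<noteq> {}"
    then have a: "\<And>t. t \<le> n \<Longrightarrow> a t \<subseteq> X" "a 0 \<noteq> {}" "a n \<noteq> {}" by simp_all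
    show "card (trajectories \<alpha> n a) = card (trajectories \<alpha> n (\<lambda>t. r ` a (n - t)))"
      using card_trajectories_reversion[of n a, OF a(1)] by simp
    show "trajectory_prob \<alpha> n a = exp (boltzmann_entropy (a n) - boltzmann_entropy (a 0)) *
        trajectory_prob \<alpha> n (\<lambda>t. r ` a (n - t))"
      by (rule trajectory_prob_reversion[of n a, OF a])
  qed (fact inv_dynamics_is_reversed_process reversible_process_iff_card
      invariant_reversion_imp_reversible_process)+
qed

end
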